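(* Let $T$ be a tree on $n$ vertices $1,2,\ldots,n$ with $n\ge2$. Let $\lambda_1<\mu_1<\lambda_2<\cdots<\mu_{n-1}<\lambda_n$ be $2n-1$ real numbers such that $\lambda_j=-\lambda_{n+1-j}$ for all $j=1,\ldots,n$, and $\mu_k=-\mu_{n-k}$ for all $k=1,\ldots,n-1$. Suppose $T$ is NEB at a vertex $v$. Let $A\in S^-(T)$ be the skew-symmetric matrix with eigenvalues $\mathrm{i}\lambda_1,\ldots,\mathrm{i}\lambda_n$, and with $A(v)$ having eigenvalues $\mathrm{i}\mu_1,\ldots,\mathrm{i}\mu_{n-1}$, that is produced from these data by the recursive construction described in the context. Then $A$ has the Duarte property with respect to vertex $v$.
   Context: $\mathrm{i}=\sqrt{-1}$. For a real skew-symmetric matrix $A=[a_{k,l}]$ of order $n$, its graph $G(A)$ has vertex set $\{1,\ldots,n\}$ and edge set $\{\{k,l\}: a_{k,l}\ne 0,\ k<l\}$. $S^-(T)$ is the set of all real skew-symmetric matrices whose graph is $T$. $N(w)$ is the set of neighbors of a vertex $w$. For a vertex $w$ of a tree $T$, $T(w)$ is the forest obtained by deleting $w$; for a neighbor $u$ of $w$, $T_u(w)$ is the connected component of $T(w)$ containing $u$. For $A\in S^-(T)$, $A(w)$ and $A_u(w)$ denote the principal submatrices of $A$ corresponding to $T(w)$ and $T_u(w)$ (rows and columns keep their vertex labels). NEB (nearly even branching; recursive): let $T$ be a tree on $n$ vertices and $w$ a vertex of $T$. If $n=1$, $T$ is NEB at $w$. If $n\ge2$, $T$ is NEB at $w$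 if (i) $T(w)$ has exactly one odd component (a connected component with an odd number of vertices) when $n$ is even, and no odd component when $n$ is odd; and (ii) for each neighbor $u$ of $w$ in $T$, $T_u(w)$ is NEB at $u$. Order on $\mathrm{i}\mathbb{R}$: $a\le b$ means $-\mathrm{i}a\le-\mathrm{i}b$ as real numbers. Spectra of real skew-symmetric matrices (contained in $\mathrm{i}\mathbb{R}$) are listed with multiplicity in increasing order; $\{\beta_1,\ldots,\beta_{n-1}\}$ strictly interlaces $\{\alpha_1,\ldots,\alpha_n\}$ if $\alpha_1<\beta_1<\alpha_2<\cdots<\beta_{n-1}<\alpha_n$. Duarte property (recursive): let $A$ be a square matrix whose graph is a tree and $w$ a vertex of $G(A)$. If $G(A)$ has just one vertex, $A$ has the Duarte property with respect to $w$. If $G(A)$ has more than one vertex, $A$ has the Duarte property with respect to $w$ provided the eigenvalues of $A(w)$ strictly interlace those of $A$ and, for each neighbor $u$ of $w$, $A_u(w)$ has the Duarte property with respect to $u$. Construction of $A$ (recursive on $n$), given a tree $T$ that is NEB at $v$ and real numbers $\lambda_j,\mu_k$ as in the claim. If $n=1$, the matrix is $[0]$. If $n=2$ (so $\mu_1=0$), the matrix is $\begin{bmatrix}0&\lambda_1\\-\lambda_1&0\end{bmatrix}$. If $n\ge3$, put $f(x)=\prod_{j=1}^n(x-\mathrm{i}\lambda_j)$ and $g(x)=\prod_{k=1}^{n-1}(x-\mathrm{i}\mu_k)$. For each $j\in N(v)$ choose a monic polynomial $g_j$ of degree $|T_j(v)|$ (the number of vertices of $T_j(v)$), whose roots are $0$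 or complex conjugate pairs of purely imaginary numbers, such that $g=\prod_{j\in N(v)}g_j$; this is possible because $T$ is NEB at $v$. The partial fraction decomposition gives $$\frac{f(x)}{g(x)}=x+\sum_{j\in N(v)}y_j\frac{h_j(x)}{g_j(x)}$$ with numbers $y_j$ and unique monic polynomials $h_j$, $\deg h_j<\deg g_j$. Here each $y_j$ is a positive real number, each $h_j$ is a real polynomial involving only powers of $x$ of the same parity as $\deg h_j$, and $h_j$ has $\deg g_j-1$ distinct roots, all purely imaginary, which strictly interlace the roots of $g_j$. Since $T_j(v)$ is NEB at $j$, the construction applied to $T_j(v)$, its vertex $j$, and the roots of $g_j$ and $h_j$ (in the roles of the $\mathrm{i}\lambda$'s and $\mathrm{i}\mu$'s) gives $B_j\in S^-(T_j(v))$ with characteristic polynomial $g_j$ such that the principal submatrix of $B_j$ obtained by deleting the row and column of vertex $j$ has characteristic polynomial $h_j$. Then $A=[a_{k,l}]$ is the $n\times n$ skew-symmetric matrix with $a_{v,j}=-a_{j,v}=\sqrt{y_j}$ and $A_j(v)=B_j$ for all $j\in N(v)$, and all other entries zero. *)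

theory Defs
  imports
    Complex_Main
    "HOL-Computational_Algebra.Polynomial_Factorial"
    "Graph_Theory.Digraph_Component"
    "Jordan_Normal_Form.Char_Poly"
begin

section \<open>Trees and nearly even branching\<close>

text \<open>
  A finite simple graph is a \<^locale>\<open>pair_graph\<close>: each undirected edge is represented by its two
  opposite arcs.
\<close>

type_synonym ugraph = "nat pair_pre_digraph"

text \<open>
  \<^const>\<open>pre_digraph.cycle\<close> also admits the closed walk that runs along an edge and back again, so
  the cycles of the undirected graph are those of length at least 3. For the same reason
  \<^const>\<open>Digraph_Component.tree\<close>, applied to a symmetric digraph, is not the notion of a tree.
\<close>

definition is_tree :: "ugraph \<Rightarrow> bool" where
  "is_tree T \<longleftrightarrow> pair_graph T \<and> Digraph_Component.connected (with_proj T) \<and>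
     \<not> (\<exists>p. pre_digraph.cycle (with_proj T) p \<and> 3 \<le> length p)"

definition induced :: "ugraph \<Rightarrow> nat set \<Rightarrow> ugraph" where
  "induced G S = \<lparr>pverts = pverts G \<inter> S, parcs = {(x, y). (x, y) \<in> parcs G \<and> x \<in> S \<and> y \<in> S}\<rparr>"

definition neighbors :: "ugraph \<Rightarrow> nat \<Rightarrow> nat set" where
  "neighbors G w = {u. (w, u) \<in> parcs G}"

text \<open>The graph $T(w)$.\<close>

definition delete_vertex :: "ugraph \<Rightarrow> nat \<Rightarrow> ugraph" where
  "delete_vertex T w = induced T (pverts T - {w})"

text \<open>The graph $T_u(w)$: the connected component of $T(w)$ containing $u$.\<close>

definition branch :: "ugraph \<Rightarrow> nat \<Rightarrow> nat \<Rightarrow> ugraph" where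
  "branch T w u = induced T {x. reachable (with_proj (delete_vertex T w)) u x}"

definition odd_components :: "ugraph \<Rightarrow> nat set set" where
  "odd_components G = {C \<in> pre_digraph.sccs_verts (with_proj G). odd (card C)}"

inductive NEB :: "ugraph \<Rightarrow> nat \<Rightarrow> bool" where
  NEB_single: "is_tree T \<Longrightarrow> pverts T = {w} \<Longrightarrow> NEB T w"
| NEB_branch:
    "is_tree T \<Longrightarrow> w \<in> pverts T \<Longrightarrow> 2 \<le> card (pverts T) \<Longrightarrow>
     card (odd_components (delete_vertex T w)) = (if even (card (pverts T)) then 1 else 0) \<Longrightarrow>
     \<forall>u\<in>neighbors T w. NEB (branch T w u) u \<Longrightarrow>
     NEB T w"

section \<open>Labelled matrices and their spectra\<close>

text \<open>
  A real matrix whose rows and columns are labelled by a finite set \<open>V\<close> of naturals is given by \<open>V\<close>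
  and a function \<open>a\<close>, whose values outside \<open>V \<times> V\<close> are irrelevant. The principal submatrix on
  \<open>W \<subseteq> V\<close> is then given by \<open>W\<close> and the same \<open>a\<close>. The rows and columns of \<open>to_mat V a\<close>
  follow the increasing order of the labels.
\<close>

definition to_mat :: "nat set \<Rightarrow> (nat \<Rightarrow> nat \<Rightarrow> real) \<Rightarrow> complex mat" where
  "to_mat V a = mat (card V) (card V)
     (\<lambda>(i, j). complex_of_real (a (sorted_list_of_set V ! i) (sorted_list_of_set V ! j)))"

definition spectrum_mset :: "nat set \<Rightarrow> (nat \<Rightarrow> nat \<Rightarrow> real) \<Rightarrow> complex multiset" where
  "spectrum_mset V a = proots (char_poly (to_mat V a))"

definition matrix_graph :: "nat set \<Rightarrow> (nat \<Rightarrow> nat \<Rightarrow> real) \<Rightarrow> ugraph" where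
  "matrix_graph V a = \<lparr>pverts = V,
     parcs = {(k, l). k \<in> V \<and> l \<in> V \<and> (k < l \<and> a k l \<noteq> 0 \<or> l < k \<and> a l k \<noteq> 0)}\<rparr>"

definition skew_symmetric_on :: "nat set \<Rightarrow> (nat \<Rightarrow> nat \<Rightarrow> real) \<Rightarrow> bool" where
  "skew_symmetric_on V a \<longleftrightarrow> (\<forall>k\<in>V. \<forall>l\<in>V. a k l = - a l k)"

text \<open>The set $S^-(T)$.\<close>

definition skew_matrices :: "ugraph \<Rightarrow> (nat \<Rightarrow> nat \<Rightarrow> real) set" where
  "skew_matrices T = {a. skew_symmetric_on (pverts T) a \<and> matrix_graph (pverts T) a = T}"

section \<open>Strict interlacing and the Duarte property\<close>

text \<open>
  The purely imaginary number \<open>\<i> * t\<close> is ordered according to \<open>t\<close>. The chain of inequalities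
  forces \<open>as\<close> and \<open>bs\<close> to be the increasing listings.
\<close>

definition strictly_interlaces :: "complex multiset \<Rightarrow> complex multiset \<Rightarrow> bool" where
  "strictly_interlaces N M \<longleftrightarrow>
     (\<exists>as bs :: real list.
        M = image_mset (\<lambda>t. \<i> * complex_of_real t) (mset as) \<and>
        N = image_mset (\<lambda>t. \<i> * complex_of_real t) (mset bs) \<and>
        length as = Suc (length bs) \<and>
        (\<forall>k<length bs. as ! k < bs ! k \<and> bs ! k < as ! Suc k))"

inductive Duarte :: "nat set \<Rightarrow> (nat \<Rightarrow> nat \<Rightarrow> real) \<Rightarrow> nat \<Rightarrow> bool" where
  Duarte_single: "V = {w} \<Longrightarrow> Duarte V a w"
| Duarte_branch:
    "is_tree (matrix_graph V a) \<Longrightarrow> w \<in> V \<Longrightarrow> 1 < card V \<Longrightarrow>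
     strictly_interlaces (spectrum_mset (V - {w}) a) (spectrum_mset V a) \<Longrightarrow>
     \<forall>u\<in>neighbors (matrix_graph V a) w. Duarte (pverts (branch (matrix_graph V a) w u)) a u \<Longrightarrow>
     Duarte V a w"

section \<open>The recursive construction\<close>

text \<open>$\prod_{j=1}^{n} (x - \mathrm{i}\, t_j)$\<close>

definition imag_roots_poly :: "nat \<Rightarrow> (nat \<Rightarrow> real) \<Rightarrow> complex poly" where
  "imag_roots_poly n t = (\<Prod>j\<in>{1..n}. [:- (\<i> * complex_of_real (t j)), 1:])"

text \<open>The roots are 0 or come in complex conjugate pairs of purely imaginary numbers.\<close>

definition conjugate_imag_roots :: "complex poly \<Rightarrow> bool" where
  "conjugate_imag_roots p \<longleftrightarrow>
     (\<forall>z. poly p z = 0 \<longrightarrow> Re z = 0 \<and> order (cnj z) p = order z p)"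

text \<open>
  \<open>constructed T v lam mu a\<close>: the matrix \<open>a\<close>, labelled by the vertices of \<open>T\<close>, is a possible outcome of
  the construction; it is a relation because the factors \<open>g\<^sub>j\<close> are chosen. The data \<open>lam\<close> and \<open>mu\<close>
  are indexed from 1. In the recursive calls \<open>lam' j\<close> and \<open>mu' j\<close> list, with multiplicity and in
  increasing order, the roots of \<open>g\<^sub>j\<close> and \<open>h\<^sub>j\<close> divided by \<open>\<i>\<close>. That \<open>y j\<close> is positive and that the
  roots of \<open>h\<^sub>j\<close> strictly interlace those of \<open>g\<^sub>j\<close> are consequences, hence not part of the rules.
\<close>

inductive constructed ::
  "ugraph \<Rightarrow> nat \<Rightarrow> (nat \<Rightarrow> real) \<Rightarrow> (nat \<Rightarrow> real) \<Rightarrow> (nat \<Rightarrow> nat \<Rightarrow> real) \<Rightarrow> bool" where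
  constructed_1:
    "pverts T = {v} \<Longrightarrow> a v v = 0 \<Longrightarrow> constructed T v lam mu a"
| constructed_2:
    "pverts T = {p, q} \<Longrightarrow> p < q \<Longrightarrow> v \<in> {p, q} \<Longrightarrow>
     a p p = 0 \<Longrightarrow> a p q = lam 1 \<Longrightarrow> a q p = - lam 1 \<Longrightarrow> a q q = 0 \<Longrightarrow>
     constructed T v lam mu a"
| constructed_step:
    "v \<in> pverts T \<Longrightarrow> card (pverts T) = n \<Longrightarrow> 3 \<le> n \<Longrightarrow>
     f = imag_roots_poly n lam \<Longrightarrow> g = imag_roots_poly (n - 1) mu \<Longrightarrow>
     \<forall>j\<in>neighbors T v. lead_coeff (g\<^sub>j j) = 1 \<and> degree (g\<^sub>j j) = card (pverts (branch T v j)) \<and>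
       conjugate_imag_roots (g\<^sub>j j) \<Longrightarrow>
     g = (\<Prod>j\<in>neighbors T v. g\<^sub>j j) \<Longrightarrow>
     \<forall>j\<in>neighbors T v. lead_coeff (h\<^sub>j j) = 1 \<and> degree (h\<^sub>j j) < degree (g\<^sub>j j) \<Longrightarrow>
     to_fract f / to_fract g = to_fract [:0, 1:] +
       (\<Sum>j\<in>neighbors T v.
          to_fract [:complex_of_real (y j):] * (to_fract (h\<^sub>j j) / to_fract (g\<^sub>j j))) \<Longrightarrow>
     \<forall>j\<in>neighbors T v.
       mono_on {1..degree (g\<^sub>j j)} (lam' j) \<and> g\<^sub>j j = imag_roots_poly (degree (g\<^sub>j j)) (lam' j) \<and>
       mono_on {1..degree (h\<^sub>j j)} (mu' j) \<and> h\<^sub>j j = imag_roots_poly (degree (h\<^sub>j j)) (mu' j) \<and>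
       constructed (branch T v j) j (lam' j) (mu' j) (B j) \<Longrightarrow>
     skew_symmetric_on (pverts T) a \<Longrightarrow>
     \<forall>j\<in>neighbors T v. a v j = sqrt (y j) \<and> a j v = - sqrt (y j) \<Longrightarrow>
     \<forall>j\<in>neighbors T v. \<forall>k\<in>pverts (branch T v j). \<forall>l\<in>pverts (branch T v j). a k l = B j k l \<Longrightarrow>
     \<forall>k\<in>pverts T. \<forall>l\<in>pverts T.
       \<not> (k = v \<and> l \<in> neighbors T v) \<and> \<not> (l = v \<and> k \<in> neighbors T v) \<and>
       \<not> (\<exists>j\<in>neighbors T v. k \<in> pverts (branch T v j) \<and> l \<in> pverts (branch T v j)) \<longrightarrow> a k l = 0 \<Longrightarrow>
     constructed T v lam mu a"

end

theory Submission
  imports Defs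
begin

text \<open>
  Strict interlacing at the root of a tree is inherited by its branches, so the interlacing at \<open>v\<close>
  propagates through the whole recursion. Let \<open>\<phi>\<close> denote the characteristic polynomial, \<open>V\<close> the vertex
  set, \<open>C\<close> the branch at \<open>w\<close> containing the neighbor \<open>j\<close>, and \<open>D\<close> the set of the remaining vertices.
  Cutting the edge \<open>{w, j}\<close> gives \<open>\<phi>(V) = \<phi>(C) \<phi>(D) + a\<^sub>w\<^sub>j\<^sup>2 \<phi>(C - j) \<phi>(D - w)\<close> and
  \<open>\<phi>(V - w) = \<phi>(C) \<phi>(D - w)\<close>. At a root of \<open>\<phi>(C)\<close>, the quotient of \<open>\<phi>(C - j)\<close> by the derivative of
  \<open>\<phi>(C)\<close> is therefore a positive multiple of the quotient of \<open>\<phi>(V)\<close> by the derivative of \<open>\<phi>(V - w)\<close>,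
  which the interlacing makes positive. So \<open>\<phi>(C - j)\<close> has a root between any two consecutive roots of
  \<open>\<phi>(C)\<close>, and these are all its roots.
\<close>

section \<open>Branches of a tree\<close>

lemma pverts_induced [simp]: "pverts (induced G S) = pverts G \<inter> S"
  and parcs_induced [simp]: "parcs (induced G S) = {(x, y). (x, y) \<in> parcs G \<and> x \<in> S \<and> y \<in> S}"
  by (simp_all add: induced_def)

lemma pair_graph_induced:
  assumes "pair_graph G"
  shows "pair_graph (induced G S)"
proof -
  interpret pair_graph G by fact
  have "parcs (induced G S) \<subseteq> parcs G" by auto
  then have "finite (parcs (induced G S))"
    using pair_finite_arcs by (rule finite_subset)
  then show ?thesis
    by unfold_locales
      (auto simp: symmetric_def intro: in_arcsD1 in_arcsD2 arcs_symmetric symI pair_finite_verts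
        dest: no_loops')
qed

lemma subgraph_induced:
  assumes "pair_graph G"
  shows "subgraph (with_proj (induced G S)) (with_proj G)"
proof -
  interpret pair_graph G by fact
  interpret I: pair_graph "induced G S" by (rule pair_graph_induced) fact
  show ?thesis
    by (auto simp: subgraph_def compatible_def wf_digraph_axioms I.wf_digraph_axioms)
qed

lemma mem_neighbors [simp]: "u \<in> neighbors T w \<longleftrightarrow> (w, u) \<in> parcs T"
  by (simp add: neighbors_def)

lemma pverts_branch:
  assumes "pair_graph T"
  shows "pverts (branch T w u) = {x. reachable (with_proj (delete_vertex T w)) u x}"
proof -
  interpret pair_graph "delete_vertex T w"
    unfolding delete_vertex_def using assms by (rule pair_graph_induced)
  have "x \<in> pverts T" if "reachable (with_proj (delete_vertex T w)) u x" for x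
    using reachable_in_verts(2)[OF that] by (simp add: delete_vertex_def)
  then show ?thesis
    by (auto simp: branch_def)
qed

lemma pverts_branch_subset:
  assumes "pair_graph T"
  shows "pverts (branch T w u) \<subseteq> pverts T - {w}"
proof -
  interpret pair_graph "delete_vertex T w"
    unfolding delete_vertex_def using assms by (rule pair_graph_induced)
  have "x \<in> pverts T - {w}" if "reachable (with_proj (delete_vertex T w)) u x" for x
    using reachable_in_verts(2)[OF that] by (simp add: delete_vertex_def)
  then show ?thesis
    using assms by (auto simp: pverts_branch)
qed

lemma self_in_branch:
  assumes "pair_graph T" "(w, u) \<in> parcs T"
  shows "u \<in> pverts (branch T w u)"
proof -
  interpret T: pair_graph T by fact
  interpret pair_graph "delete_vertex T w"
    unfolding delete_vertex_def using assms(1) by (rule pair_graph_induced)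
  have "u \<in> pverts (delete_vertex T w)"
    using assms T.in_arcsD2 T.no_loops' by (auto simp: delete_vertex_def)
  then show ?thesis
    using assms by (simp add: pverts_branch)
qed

lemma branch_closed:
  assumes "pair_graph T" "x \<in> pverts (branch T w u)" "(x, y) \<in> parcs T" "y \<noteq> w"
  shows "y \<in> pverts (branch T w u)"
proof -
  interpret T: pair_graph T by fact
  interpret pair_graph "delete_vertex T w"
    unfolding delete_vertex_def using assms(1) by (rule pair_graph_induced)
  have "x \<noteq> w"
    using assms pverts_branch_subset by blast
  then have "(x, y) \<in> parcs (delete_vertex T w)"
    using assms T.wellformed' by (auto simp: delete_vertex_def)
  moreover have "reachable (with_proj (delete_vertex T w)) u x"
    using assms by (simp add: pverts_branch)
  ultimately have "reachable (with_proj (delete_vertex T w)) u y"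
    by (metis reachable_adj_trans)
  then show ?thesis
    using assms by (simp add: pverts_branch)
qed

lemma is_tree_branch:
  assumes "is_tree T" "(w, u) \<in> parcs T"
  shows "is_tree (branch T w u)"
proof -
  let ?B = "branch T w u"
  interpret T: pair_graph T using assms by (simp add: is_tree_def)
  interpret D: pair_graph "delete_vertex T w"
    unfolding delete_vertex_def by (rule pair_graph_induced) unfold_locales
  interpret B: pair_graph ?B
    unfolding branch_def by (rule pair_graph_induced) unfold_locales
  \<comment> \<open>Every vertex on a walk from \<open>u\<close> in \<open>T(w)\<close> is itself
    reachable from \<open>u\<close>, so the walk stays inside the branch; the induction adds one arc
    at a time.\<close>
  have "reachable (with_proj ?B) u x" if "reachable (with_proj (delete_vertex T w)) u x" for x
    using that
  proof (induction rule: D.reachable_induct)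
    case base
    have "u \<in> pverts ?B"
      using assms by (simp add: self_in_branch T.pair_graph)
    then show ?case by simp
  next
    case (step x y)
    then have "reachable (with_proj (delete_vertex T w)) u y"
      by (metis D.reachable_adj_trans)
    then have "(x, y) \<in> parcs ?B"
      using step by (auto simp: branch_def delete_vertex_def)
    then show ?case
      using step.IH by (metis B.reachable_adj_trans)
  qed
  then have reach: "reachable (with_proj ?B) u x" if "x \<in> pverts ?B" for x
    using that by (simp add: pverts_branch[OF T.pair_graph])
  have "Digraph_Component.connected (with_proj ?B)"
  proof (rule B.connectedI)
    show "pverts ?B \<noteq> {}"
      using self_in_branch[OF T.pair_graph assms(2)] by auto
    fix x y assume "x \<in> pverts ?B" "y \<in> pverts ?B"
    then have "reachable (with_proj ?B) x u" "reachable (with_proj ?B) u y"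
      using reach by (blast intro: B.symmetric_reachable')+
    then have "reachable (with_proj ?B) x y"
      by (rule B.reachable_trans)
    then show "reachable (with_proj (mk_symmetric (with_proj ?B))) x y"
      by (rule B.reachable_mk_symmetricI)
  qed
  moreover have "subgraph (with_proj ?B) (with_proj T)"
    unfolding branch_def by (rule subgraph_induced) unfold_locales
  then have "T.cycle p" if "B.cycle p" for p
    using T.subgraph_cycle that by blast
  ultimately show ?thesis
    using assms(1) B.pair_graph unfolding is_tree_def by blast
qed

text \<open>A path inside the branch from \<open>u\<close> to a second neighbor \<open>x\<close> of
  \<open>w\<close> avoids \<open>w\<close>, so it closes up through \<open>w\<close> to a cycle,
  which a tree does not have.\<close>

lemma branch_single_attachment:
  assumes "is_tree T" "(w, u) \<in> parcs T" "x \<in> pverts (branch T w u)" "(w, x) \<in> parcs T"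
  shows "x = u"
proof (rule ccontr)
  assume "x \<noteq> u"
  interpret T: pair_graph T using assms by (simp add: is_tree_def)
  let ?D = "delete_vertex T w"
  interpret D: pair_graph ?D
    unfolding delete_vertex_def by (rule pair_graph_induced) unfold_locales
  have "reachable (with_proj ?D) u x"
    using assms by (simp add: pverts_branch[OF T.pair_graph])
  then obtain p where p: "D.apath u p x"
    using D.reachable_apath by blast
  have sub: "subgraph (with_proj ?D) (with_proj T)"
    unfolding delete_vertex_def by (rule subgraph_induced) unfold_locales
  have walk: "D.awalk u p x" and dist: "distinct (pawalk_verts u p)"
    using p by (simp_all add: D.apath_def)
  then have "T.awalk u p x"
    using T.subgraph_awalk_imp_awalk[OF _ sub] by blast
  moreover have "set (pawalk_verts u p) \<subseteq> pverts ?D"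
    using walk D.awalk_verts_in_verts by blast
  then have "w \<notin> set (pawalk_verts u p)"
    by (auto simp: delete_vertex_def)
  moreover have "p \<noteq> []"
    using walk \<open>x \<noteq> u\<close> by (auto simp: D.awalk_Nil_iff)
  moreover have xw: "(x, w) \<in> parcs T"
    using assms(4) by (rule T.arcs_symmetric)
  ultimately have "T.awalk w ((w, u) # p @ [(x, w)]) w"
    using assms by (auto simp: T.awalk_simps T.wellformed')
  \<comment> \<open>Appending an arc adds just its head to the visited vertices because the walk
    ends at the tail of that arc, which is what \<open>pcas\<close> records.\<close>
  moreover have "pawalk_verts u (p @ [(x, w)]) = pawalk_verts u p @ [w]"
    if "pcas u p x" for u
    using that by (induction p arbitrary: u) auto
  then have "pawalk_verts u (p @ [(x, w)]) = pawalk_verts u p @ [w]"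
    using walk by (simp add: D.awalk_def)
  ultimately have "T.cycle ((w, u) # p @ [(x, w)])"
    using dist \<open>w \<notin> _\<close> by (auto simp: T.cycle_def)
  \<comment> \<open>The path has at least one arc because \<open>x \<noteq> u\<close>. With the two
    arcs at \<open>w\<close> this meets the length bound by which \<open>is_tree\<close> tells
    genuine cycles from an edge run back and forth.\<close>
  moreover have "3 \<le> length ((w, u) # p @ [(x, w)])"
    using \<open>p \<noteq> []\<close> by (cases p) auto
  ultimately show False
    using assms(1) unfolding is_tree_def by blast
qed

section \<open>Matrix graphs and their branches\<close>

lemma matrix_graph_branch:
  assumes "C = pverts (branch (matrix_graph V a) w u)"
  shows "branch (matrix_graph V a) w u = matrix_graph C a"
proof -
  have "branch (matrix_graph V a) w u = induced (matrix_graph V a) C"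
    by (auto simp: assms branch_def induced_def matrix_graph_def)
  moreover have "C \<subseteq> V"
    by (auto simp: assms branch_def matrix_graph_def)
  ultimately show ?thesis
    by (auto simp: induced_def matrix_graph_def)
qed

text \<open>\<open>matrix_graph\<close> reads only the entries above the diagonal; skew-symmetry
  carries them over to the entries below it and makes the diagonal vanish.\<close>

lemma matrix_graph_arc:
  assumes "skew_symmetric_on V a"
  shows "(k, l) \<in> parcs (matrix_graph V a) \<longleftrightarrow> k \<in> V \<and> l \<in> V \<and> a k l \<noteq> 0"
proof -
  have "a k k = 0" if "k \<in> V"
    using assms that unfolding skew_symmetric_on_def by (metis equal_neg_zero)
  moreover have "a k l = 0 \<longleftrightarrow> a l k = 0" if "k \<in> V" "l \<in> V"
    using assms that unfolding skew_symmetric_on_def by (metis neg_equal_0_iff_equal)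
  ultimately show ?thesis
    by (cases k l rule: linorder_cases) (auto simp: matrix_graph_def)
qed

section \<open>Determinants over a finite set of labels\<close>

text \<open>The Leibniz formula, indexed by labels instead of positions, so that passing to a
  principal submatrix or splitting the label set needs no renumbering. On the empty set its value is
  1.\<close>

definition principal_det :: "'b set \<Rightarrow> ('b \<Rightarrow> 'b \<Rightarrow> 'a) \<Rightarrow> 'a::comm_ring_1" where
  "principal_det V M = (\<Sum>p | p permutes V. of_int (sign p) * (\<Prod>i\<in>V. M i (p i)))"

lemma principal_det_cong:
  assumes "\<And>k l. k \<in> V \<Longrightarrow> l \<in> V \<Longrightarrow> M k l = N k l"
  shows "principal_det V M = principal_det V N"
  unfolding principal_det_def
  by (intro sum.cong refl arg_cong2[where f = "(*)"] prod.cong)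
    (auto simp: assms permutes_in_image)

lemma principal_det_row_add:
  assumes "finite V" "r \<in> V"
  shows "principal_det V (M(r := (\<lambda>l. f l + g l)))
    = principal_det V (M(r := f)) + principal_det V (M(r := g))"
proof -
  have "(\<Prod>i\<in>V. (M(r := (\<lambda>l. f l + g l))) i (p i))
    = (\<Prod>i\<in>V. (M(r := f)) i (p i)) + (\<Prod>i\<in>V. (M(r := g)) i (p i))" for p
  proof -
    have *: "(\<Prod>i\<in>V. (M(r := h)) i (p i)) = h (p r) * (\<Prod>i\<in>V - {r}. M i (p i))" for h
      by (subst prod.remove[OF assms]) simp
    show ?thesis
      unfolding * by (simp add: algebra_simps)
  qed
  then show ?thesis
    by (simp add: principal_det_def algebra_simps sum.distrib)
qed

lemma principal_det_zero_row:
  assumes "finite V" "r \<in> V" "\<And>l. l \<in> V \<Longrightarrow> M r l = 0"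
  shows "principal_det V M = 0"
proof -
  have "(\<Prod>i\<in>V. M i (p i)) = 0" if "p permutes V" for p
    using assms that by (intro prod_zero bexI[of _ r]) (auto simp: permutes_in_image)
  then show ?thesis
    by (simp add: principal_det_def)
qed

text \<open>Composing every permutation with the transposition reindexes the Leibniz sum, keeps the
  products and flips the signs.\<close>

lemma principal_det_swap_rows:
  assumes "finite V" "r \<in> V" "s \<in> V" "r \<noteq> s"
  shows "principal_det V (\<lambda>k. M (Transposition.transpose r s k)) = - principal_det V M"
proof -
  let ?t = "Transposition.transpose r s"
  have t: "?t permutes V"
    using assms by (simp add: permutes_swap_id)
  have "principal_det V (\<lambda>k. M (?t k)) =
    (\<Sum>p | p permutes V. of_int (sign (p \<circ> ?t)) * (\<Prod>i\<in>V. M (?t i) ((p \<circ> ?t) i)))"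
    unfolding principal_det_def
    using permutes_compose[OF t]
    by (intro sum.reindex_bij_witness[of _ "\<lambda>p. p \<circ> ?t" "\<lambda>p. p \<circ> ?t"])
      (auto simp: comp_assoc)
  also have "\<dots> = (\<Sum>p | p permutes V. - (of_int (sign p) * (\<Prod>i\<in>V. M i (p i))))"
  proof (intro sum.cong refl)
    fix p assume "p \<in> {p. p permutes V}"
    then have "permutation p"
      using assms permutation_permutes by blast
    then have "sign (p \<circ> ?t) = - sign p"
      using assms by (simp add: sign_compose sign_swap_id permutation_swap_id)
    moreover have "(\<Prod>i\<in>V. M (?t i) ((p \<circ> ?t) i)) = (\<Prod>i\<in>V. M i (p i))"
      using prod.permute[OF t, of "\<lambda>i. M i (p i)"] by (simp add: o_def)
    ultimately show "of_int (sign (p \<circ> ?t)) * (\<Prod>i\<in>V. M (?t i) ((p \<circ> ?t) i))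
      = - (of_int (sign p) * (\<Prod>i\<in>V. M i (p i)))"
      by simp
  qed
  finally show ?thesis
    by (simp add: principal_det_def sum_negf)
qed

text \<open>Passing to inverse permutations reindexes the sum: an inverse has the same sign, and
  each product only changes the order of its factors.\<close>

lemma principal_det_transpose:
  assumes "finite V"
  shows "principal_det V (\<lambda>k l. M l k) = principal_det V M"
proof -
  have "principal_det V (\<lambda>k l. M l k) =
    (\<Sum>p | p permutes V. of_int (sign (Hilbert_Choice.inv p)) * (\<Prod>i\<in>V. M (Hilbert_Choice.inv p i) i))"
    unfolding principal_det_def
    by (intro sum.reindex_bij_witness[of _ Hilbert_Choice.inv Hilbert_Choice.inv]) (auto simp: permutes_inv permutes_inv_inv)
  also have "\<dots> = principal_det V M"
    unfolding principal_det_def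
  proof (intro sum.cong refl)
    fix p assume "p \<in> {p. p permutes V}"
    then have p: "p permutes V" by simp
    then have "permutation p"
      using assms permutation_permutes by blast
    then have "sign (Hilbert_Choice.inv p) = sign p"
      by (rule sign_inverse)
    moreover have "(\<Prod>i\<in>V. M (Hilbert_Choice.inv p i) i) = (\<Prod>i\<in>V. M i (p i))"
      using prod.permute[OF p, of "\<lambda>i. M (Hilbert_Choice.inv p i) i"] by (simp add: o_def permutes_inverses[OF p])
    ultimately show "of_int (sign (Hilbert_Choice.inv p)) * (\<Prod>i\<in>V. M (Hilbert_Choice.inv p i) i)
      = of_int (sign p) * (\<Prod>i\<in>V. M i (p i))"
      by simp
  qed
  finally show ?thesis .
qed

text \<open>A term survives only if its permutation maps \<open>C\<close> into, hence onto, itself;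
  then it also maps \<open>C'\<close> onto itself. Such a permutation is an independent pair of
  permutations of the two blocks, so the sum factors.\<close>

lemma principal_det_block_triangular:
  assumes fin: "finite C" "finite C'" and disj: "C \<inter> C' = {}"
    and zero: "\<And>k l. k \<in> C \<Longrightarrow> l \<in> C' \<Longrightarrow> M k l = 0"
  shows "principal_det (C \<union> C') M = principal_det C M * principal_det C' M"
proof -
  let ?t = "\<lambda>V p. of_int (sign p) * (\<Prod>i\<in>V. M i (p i))"
  let ?P = "{p. p permutes C \<union> C' \<and> p ` C = C}"
  have vanish: "?t (C \<union> C') p = 0" if "p permutes C \<union> C'" "p ` C \<noteq> C" for p
  proof -
    have "\<not> p ` C \<subseteq> C"
      using that fin by (metis card_image card_subset_eq permutes_inj_on)
    then obtain k where k: "k \<in> C" "p k \<notin> C" by blast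
    then have "p k \<in> C'"
      using that(1) by (metis UnCI UnE permutes_in_image)
    then have "(\<Prod>i\<in>C \<union> C'. M i (p i)) = 0"
      using fin k zero by (intro prod_zero) auto
    then show ?thesis by simp
  qed
  have img': "p ` C' = C'" if "p \<in> ?P" for p
  proof -
    have "C' = (C \<union> C') - C"
      using disj by blast
    then have "p ` C' = p ` (C \<union> C') - p ` C"
      using that permutes_inj[of p "C \<union> C'"] by (metis (lifting) image_set_diff mem_Collect_eq)
    then show ?thesis
      using that permutes_image[of p "C \<union> C'"] disj by auto
  qed
  have "principal_det (C \<union> C') M = sum (?t (C \<union> C')) ?P"
    unfolding principal_det_def
  proof (rule sum.mono_neutral_right)
    show "finite {p. p permutes C \<union> C'}"
      using fin by (simp add: finite_permutations)
    show "\<forall>p\<in>{p. p permutes C \<union> C'} - ?P. ?t (C \<union> C') p = 0"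
      using vanish by blast
  qed auto
  also have "\<dots> = (\<Sum>(q, r)\<in>{q. q permutes C} \<times> {r. r permutes C'}. ?t C q * ?t C' r)"
  \<comment> \<open>\<open>restrict_id p C\<close> agrees with \<open>p\<close> on \<open>C\<close>
    and is the identity elsewhere, so the two restrictions compose back to \<open>p\<close>, and the
    sign of \<open>p\<close> is the product of their signs.\<close>
  proof (intro sum.reindex_bij_witness[of _ "\<lambda>(q, r). q \<circ> r" "\<lambda>p. (restrict_id p C, restrict_id p C')"])
    fix p assume p: "p \<in> ?P"
    then have bij: "bij_betw p C C" "bij_betw p C' C'"
      using img'[OF p] permutes_inj_on[of p "C \<union> C'"] unfolding bij_betw_def by blast+
    from bij show res: "(restrict_id p C, restrict_id p C') \<in> {q. q permutes C} \<times> {r. r permutes C'}"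
      by (simp add: permutes_restrict_id)
    show eq: "(case (restrict_id p C, restrict_id p C') of (q, r) \<Rightarrow> q \<circ> r) = p"
    proof
      fix x
      show "(case (restrict_id p C, restrict_id p C') of (q, r) \<Rightarrow> q \<circ> r) x = p x"
        using p img'[OF p] disj permutes_not_in[of p "C \<union> C'" x] imageI[of x C' p]
        by (auto simp: restrict_id_def)
    qed
    have perm: "permutation (restrict_id p C)" "permutation (restrict_id p C')"
      using res fin permutation_permutes by blast+
    have "sign p = sign (restrict_id p C) * sign (restrict_id p C')"
      using sign_compose[OF perm] eq by simp
    moreover have "(\<Prod>i\<in>C \<union> C'. M i (p i))
      = (\<Prod>i\<in>C. M i (restrict_id p C i)) * (\<Prod>i\<in>C'. M i (restrict_id p C' i))"
      using fin disj by (simp add: prod.union_disjoint)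
    ultimately show "(case (restrict_id p C, restrict_id p C') of (q, r) \<Rightarrow> ?t C q * ?t C' r)
      = ?t (C \<union> C') p"
      by (simp add: algebra_simps)
  next
    fix qr assume qr: "qr \<in> {q. q permutes C} \<times> {r. r permutes C'}"
    then obtain q r where [simp]: "qr = (q, r)" and q: "q permutes C" and r: "r permutes C'"
      by auto
    have qC: "(q \<circ> r) x = q x" if "x \<in> C" for x
      using that disj permutes_not_in[OF r] by (metis comp_apply disjoint_iff)
    have rC: "(q \<circ> r) x = r x" if "x \<in> C'" for x
      using that disj permutes_in_image[OF r] permutes_not_in[OF q] by (metis comp_apply disjoint_iff)
    show "(restrict_id (case qr of (q, r) \<Rightarrow> q \<circ> r) C, restrict_id (case qr of (q, r) \<Rightarrow> q \<circ> r) C')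
      = qr"
      using qC rC permutes_not_in[OF q] permutes_not_in[OF r] by (auto simp: restrict_id_def)
    have "q \<circ> r permutes C \<union> C'"
      using q r by (intro permutes_compose permutes_subset[OF q] permutes_subset[OF r]) auto
    moreover have "(q \<circ> r) ` C = C"
      using qC permutes_image[OF q] by (metis image_cong)
    ultimately show "(case qr of (q, r) \<Rightarrow> q \<circ> r) \<in> ?P"
      by simp
  qed
  also have "\<dots> = principal_det C M * principal_det C' M"
    by (simp add: principal_det_def sum_product sum.cartesian_product)
  finally show ?thesis .
qed

lemma principal_det_singleton [simp]: "principal_det {r} M = M r r"
  by (simp add: principal_det_def)

lemma principal_det_unit_row:
  assumes "finite V" "r \<in> V" "\<And>l. l \<in> V \<Longrightarrow> l \<noteq> r \<Longrightarrow> M r l = 0"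
  shows "principal_det V M = M r r * principal_det (V - {r}) M"
  using principal_det_block_triangular[of "{r}" "V - {r}" M] assms
  by (simp add: insert_absorb)

text \<open>By linearity row \<open>j\<close>, and then row \<open>w\<close>, is split into its part
  inside its own block and its one crossing entry. If row \<open>j\<close> stays inside, block
  triangularity gives the first product. If only row \<open>j\<close> crosses, the determinant
  vanishes. If both cross, swapping the two rows gives the second product and its minus
  sign.\<close>

lemma principal_det_cut_edge:
  assumes fin: "finite C" "finite C'" and disj: "C \<inter> C' = {}" and j: "j \<in> C" and w: "w \<in> C'"
    and cross: "\<And>k l. k \<in> C \<Longrightarrow> l \<in> C' \<Longrightarrow> (k, l) \<noteq> (j, w) \<Longrightarrow> M k l = 0 \<and> M l k = 0"
  shows "principal_det (C \<union> C') M = principal_det C M * principal_det C' M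
    - M j w * M w j * principal_det (C - {j}) M * principal_det (C' - {w}) M"
proof -
  let ?V = "C \<union> C'"
  have finV: "finite ?V" and jw: "j \<in> ?V" "w \<in> ?V" "j \<noteq> w" "j \<notin> C'" "w \<notin> C"
    using fin disj j w by auto
  define M1 where "M1 = M(j := (\<lambda>l. if l \<in> C then M j l else 0))"
  define M2 where "M2 = M(j := (\<lambda>l. if l = w then M j w else 0))"
  define M21 where "M21 = M2(w := (\<lambda>l. if l \<in> C' then M w l else 0))"
  define M22 where "M22 = M2(w := (\<lambda>l. if l = j then M w j else 0))"
  define N where "N = (\<lambda>k. M22 (Transposition.transpose j w k))"
  have "principal_det ?V M = principal_det ?V
      (M(j := (\<lambda>l. (if l \<in> C then M j l else 0) + (if l = w then M j w else 0))))"
    using jw cross j by (intro principal_det_cong) auto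
  also have "\<dots> = principal_det ?V M1 + principal_det ?V M2"
    unfolding M1_def M2_def by (rule principal_det_row_add[OF finV jw(1)])
  finally have split1: "principal_det ?V M = principal_det ?V M1 + principal_det ?V M2" .
  have "principal_det ?V M2 = principal_det ?V
      (M2(w := (\<lambda>l. (if l \<in> C' then M w l else 0) + (if l = j then M w j else 0))))"
    using jw cross w by (intro principal_det_cong) (auto simp: M2_def)
  also have "\<dots> = principal_det ?V M21 + principal_det ?V M22"
    unfolding M21_def M22_def by (rule principal_det_row_add[OF finV jw(2)])
  finally have split2: "principal_det ?V M2 = principal_det ?V M21 + principal_det ?V M22" .
  have "principal_det ?V M1 = principal_det C M1 * principal_det C' M1"
    using fin disj cross by (intro principal_det_block_triangular) (auto simp: M1_def)
  also have "principal_det C M1 = principal_det C M"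
    by (intro principal_det_cong) (auto simp: M1_def)
  also have "principal_det C' M1 = principal_det C' M"
    using jw by (intro principal_det_cong) (auto simp: M1_def)
  finally have det1: "principal_det ?V M1 = principal_det C M * principal_det C' M" .
  \<comment> \<open>Row \<open>w\<close> now has no entry in \<open>C\<close>, so the matrix is
    block triangular with the blocks in the other order. Within \<open>C\<close>, row
    \<open>j\<close> is zero because its only entry is in column \<open>w\<close>.\<close>
  have "principal_det (C' \<union> C) M21 = principal_det C' M21 * principal_det C M21"
    using fin disj cross jw by (intro principal_det_block_triangular) (auto simp: M21_def M2_def)
  moreover have "principal_det C M21 = 0"
    using fin j jw by (intro principal_det_zero_row[of _ j]) (auto simp: M21_def M2_def)
  ultimately have det21: "principal_det ?V M21 = 0"
    by (simp add: Un_commute)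
  \<comment> \<open>After the swap each edge entry sits on the diagonal and is alone in its row, so
    nothing crosses between the blocks and both rows can be expanded.\<close>
  have N: "N = M(j := (\<lambda>l. if l = j then M w j else 0), w := (\<lambda>l. if l = w then M j w else 0))"
    using jw by (auto simp: N_def M22_def M2_def fun_eq_iff Transposition.transpose_def)
  have diag: "N j j = M w j" "N w w = M j w"
    using jw by (simp_all add: N)
  have "principal_det ?V N = principal_det C N * principal_det C' N"
    using fin disj cross jw by (intro principal_det_block_triangular) (auto simp: N)
  also have "principal_det C N = N j j * principal_det (C - {j}) N"
    using fin j jw by (intro principal_det_unit_row) (auto simp: N)
  also have "principal_det (C - {j}) N = principal_det (C - {j}) M"
    using jw by (intro principal_det_cong) (auto simp: N)
  also have "principal_det C' N = N w w * principal_det (C' - {w}) N"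
    using fin w jw by (intro principal_det_unit_row) (auto simp: N)
  also have "principal_det (C' - {w}) N = principal_det (C' - {w}) M"
    using jw by (intro principal_det_cong) (auto simp: N)
  finally have "principal_det ?V N
      = M j w * M w j * principal_det (C - {j}) M * principal_det (C' - {w}) M"
    using diag by (simp only: ac_simps)
  moreover have "principal_det ?V N = - principal_det ?V M22"
    unfolding N_def by (rule principal_det_swap_rows[OF finV jw(1-3)])
  ultimately have "principal_det ?V M22
      = - (M j w * M w j * principal_det (C - {j}) M * principal_det (C' - {w}) M)"
    by (metis minus_minus)
  then show ?thesis
    by (simp only: split1 split2 det1 det21) simp
qed

section \<open>Characteristic polynomials as label-indexed determinants\<close>

lemma principal_det_reindex:
  assumes "finite A" "bij_betw e A V"
  shows "principal_det V M = principal_det A (\<lambda>i j. M (e i) (e j))"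
proof -
  let ?m = "map_permutation A e"
  have inj: "inj_on e A" and img: "e ` A = V"
    using assms by (auto simp: bij_betw_def)
  have bij': "bij_betw (inv_into A e) V A"
    using assms by (intro bij_betw_inv_into)
  \<comment> \<open>Permutations are conjugated by \<open>e\<close>, which preserves their signs and
    relabels the factors.\<close>
  have "principal_det A (\<lambda>i j. M (e i) (e j)) = principal_det V M"
    unfolding principal_det_def
  proof (rule sum.reindex_bij_witness[of _ "map_permutation V (inv_into A e)" ?m])
    fix p assume "p \<in> {p. p permutes A}"
    then have p: "p permutes A" by simp
    show "map_permutation V (inv_into A e) (?m p) = p"
      using p assms by (intro map_permutation_compose_inv) (auto simp: inj)
    show "?m p \<in> {p. p permutes V}"
      using map_permutation_permutes[OF assms(2) p] by simp
    have "(\<Prod>i\<in>V. M i (?m p i)) = (\<Prod>i\<in>A. M (e i) (?m p (e i)))"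
      using assms(2) by (rule prod.reindex_bij_betw[symmetric])
    also have "\<dots> = (\<Prod>i\<in>A. M (e i) (e (p i)))"
      by (intro prod.cong refl) (simp add: map_permutation_apply[OF inj])
    finally show "of_int (sign (?m p)) * (\<Prod>i\<in>V. M i (?m p i))
      = of_int (sign p) * (\<Prod>i\<in>A. M (e i) (e (p i)))"
      using sign_map_permutation[OF inj p assms(1)] by simp
  next
    fix q assume "q \<in> {q. q permutes V}"
    then have q: "q permutes V" by simp
    show "?m (map_permutation V (inv_into A e) q) = q"
      using q bij' assms(2) img
      by (intro map_permutation_compose_inv) (auto simp: f_inv_into_f)
    show "map_permutation V (inv_into A e) q \<in> {p. p permutes A}"
      using map_permutation_permutes[OF bij' q] by simp
  qed
  then show ?thesis by simp
qed

lemma det_eq_principal_det: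
  "Determinant.det (mat n n (\<lambda>(i, j). M i j)) = principal_det {0..<n} M"
  by (subst det_def'[of _ n])
    (auto simp: principal_det_def permutes_in_image intro!: sum.cong arg_cong2[where f = "(*)"] prod.cong)

lemma to_mat_carrier [simp]: "to_mat V a \<in> carrier_mat (card V) (card V)"
  by (simp add: to_mat_def)

text \<open>This form is free of the increasing enumeration inside \<open>to_mat\<close>, so the
  label set can be cut along a branch.\<close>

lemma char_poly_to_mat:
  assumes "finite V"
  shows "char_poly (to_mat V a) = principal_det V
    (\<lambda>k l. (if k = l then [:0, 1:] else 0) - [:complex_of_real (a k l):])"
proof -
  let ?xs = "sorted_list_of_set V"
  let ?M = "\<lambda>k l. (if k = l then [:0, 1:] else 0) - [:complex_of_real (a k l):]"
  have bij: "bij_betw ((!) ?xs) {0..<card V} V"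
    by (rule bij_betw_nth) (auto simp: assms atLeast0LessThan)
  have "char_poly_matrix (to_mat V a) = mat (card V) (card V) (\<lambda>(i, j). ?M (?xs ! i) (?xs ! j))"
    by (rule eq_matI)
      (auto simp: char_poly_matrix_def to_mat_def nth_eq_iff_index_eq assms one_pCons)
  then have "char_poly (to_mat V a) = principal_det {0..<card V} (\<lambda>i j. ?M (?xs ! i) (?xs ! j))"
    unfolding char_poly_def by (simp only: det_eq_principal_det)
  also have "\<dots> = principal_det V ?M"
    by (rule principal_det_reindex[symmetric]) (use bij in auto)
  finally show ?thesis .
qed

section \<open>Strict interlacing passes to branches\<close>

lemma prod_minus_nth_distinct:
  assumes "distinct xs" "k < length xs"
  shows "(\<Prod>x\<in>set xs - {xs ! k}. g x) = (\<Prod>i\<in>{..<length xs} - {k}. g (xs ! i))"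
proof -
  have "bij_betw ((!) xs) ({..<length xs} - {k}) (set xs - {xs ! k})"
    using assms bij_betw_nth[OF assms(1) refl refl]
    by (intro bij_betw_DiffI) (auto simp: bij_betw_def)
  then show ?thesis
    by (rule prod.reindex_bij_betw[symmetric])
qed

text \<open>The second product is the derivative at \<open>bs ! k\<close> of the monic polynomial
  with roots \<open>bs\<close>. Pair \<open>bs ! i\<close> with \<open>as ! i\<close> for
  \<open>i < k\<close> and with \<open>as ! Suc i\<close> for \<open>i > k\<close>: both members of
  a pair lie on the same side of \<open>bs ! k\<close>. The unpaired \<open>as ! k\<close> and
  \<open>as ! Suc k\<close> lie on opposite sides and decide the sign.\<close>

lemma interlacing_sign:
  fixes as bs :: "real list"
  assumes "length as = Suc (length bs)"
    and "\<forall>k<length bs. as ! k < bs ! k \<and> bs ! k < as ! Suc k"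
    and "k < length bs"
  shows "(\<Prod>i<length as. bs ! k - as ! i) * (\<Prod>i\<in>{..<length bs} - {k}. bs ! k - bs ! i) < 0"
proof -
  let ?n = "length bs" and ?b = "bs ! k"
  have mono: "as ! i < as ! j" if "i < j" "j \<le> ?n" for i j
    using that
  proof (induction j)
    case (Suc j)
    have "as ! j < as ! Suc j"
      using Suc.prems assms(2) by (meson Suc_le_lessD less_trans)
    then show ?case
      using Suc by (cases "i = j") auto
  qed simp
  have k: "k \<in> {..<length as}" "Suc k \<in> {..<length as} - {k}"
    using assms by auto
  \<comment> \<open>This index map is the pairing; its image leaves out exactly the two entries of
    \<open>as\<close> that enclose \<open>bs ! k\<close>.\<close>
  have "bij_betw (\<lambda>i. if i < k then i else Suc i) ({..<?n} - {k}) ({..<length as} - {k, Suc k})"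
    by (rule bij_betw_byWitness[where f' = "\<lambda>i. if i < k then i else i - 1"])
      (use assms in \<open>auto split: if_splits\<close>)
  then have "(\<Prod>i\<in>{..<length as} - {k, Suc k}. ?b - as ! i)
      = (\<Prod>i\<in>{..<?n} - {k}. ?b - as ! (if i < k then i else Suc i))"
    by (rule prod.reindex_bij_betw[symmetric])
  moreover have "(\<Prod>i<length as. ?b - as ! i)
      = (?b - as ! k) * ((?b - as ! Suc k) * (\<Prod>i\<in>{..<length as} - {k, Suc k}. ?b - as ! i))"
    unfolding Diff_insert2[of _ k "{Suc k}"]
    by (simp only: prod.remove[OF finite_lessThan k(1)] prod.remove[OF finite_Diff[OF finite_lessThan] k(2)])
  ultimately have "(\<Prod>i<length as. ?b - as ! i) * (\<Prod>i\<in>{..<?n} - {k}. ?b - bs ! i)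
      = (?b - as ! k) * (?b - as ! Suc k)
        * (\<Prod>i\<in>{..<?n} - {k}. (?b - as ! (if i < k then i else Suc i)) * (?b - bs ! i))"
    by (simp add: prod.distrib)
  moreover have "(?b - as ! (if i < k then i else Suc i)) * (?b - bs ! i) > 0"
    if "i \<in> {..<?n} - {k}" for i
  proof (cases "i < k")
    case True
    then have "as ! i < bs ! i" "bs ! i < as ! Suc i" "as ! k < ?b"
      using assms by auto
    moreover have "as ! Suc i \<le> as ! k"
      using True assms mono[of "Suc i" k] by (cases "Suc i = k") auto
    ultimately show ?thesis using True by (intro mult_pos_pos) auto
  next
    case False
    then have "?b < as ! Suc k" "as ! i < bs ! i" "bs ! i < as ! Suc i"
      using that assms by auto
    moreover have "as ! Suc k \<le> as ! i"
      using False that assms mono[of "Suc k" i] by (cases "Suc k = i") auto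
    ultimately show ?thesis using False by (intro mult_neg_neg) auto
  qed
  then have "(\<Prod>i\<in>{..<?n} - {k}. (?b - as ! (if i < k then i else Suc i)) * (?b - bs ! i)) > 0"
    by (rule prod_pos)
  moreover have "(?b - as ! k) * (?b - as ! Suc k) < 0"
    using assms by (intro mult_pos_neg) auto
  ultimately show ?thesis
    by (simp add: mult_neg_pos)
qed

text \<open>The two products are values of the derivative of the monic polynomial with simple roots
  \<open>S\<close>. Each root other than \<open>c\<close> and \<open>d\<close> lies on the same side
  of both, so the sign comes from \<open>c - d\<close> and \<open>d - c\<close> alone.\<close>

lemma consecutive_roots_sign:
  fixes S :: "real set"
  assumes "finite S" "c \<in> S" "d \<in> S" "c < d" and "\<And>x. x \<in> S \<Longrightarrow> x \<le> c \<or> d \<le> x"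
  shows "(\<Prod>x\<in>S - {c}. c - x) * (\<Prod>x\<in>S - {d}. d - x) < 0"
proof -
  have "(\<Prod>x\<in>S - {c}. c - x) = (c - d) * (\<Prod>x\<in>S - {c, d}. c - x)"
    using assms by (simp add: prod.remove[of _ d] Diff_insert2[symmetric] insert_commute)
  moreover have "(\<Prod>x\<in>S - {d}. d - x) = (d - c) * (\<Prod>x\<in>S - {c, d}. d - x)"
    using assms by (simp add: prod.remove[of _ c] Diff_insert2[symmetric] insert_commute)
  moreover have "(\<Prod>x\<in>S - {c, d}. (c - x) * (d - x)) > 0"
  proof (rule prod_pos)
    fix x assume "x \<in> S - {c, d}"
    with assms(5)[of x] assms(4) show "(c - x) * (d - x) > 0"
      by (auto simp: zero_less_mult_iff)
  qed
  moreover have "(c - d) * (d - c) < 0"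
    using assms by (intro mult_neg_pos) auto
  ultimately show ?thesis
    using mult_neg_pos[of "(c - d) * (d - c)" "\<Prod>x\<in>S - {c, d}. (c - x) * (d - x)"]
    by (simp add: prod.distrib mult_ac)
qed

text \<open>Counted with multiplicity there are at most \<open>degree p\<close> roots, so the
  elements of \<open>S\<close> leave no room for repeated or further ones.\<close>

lemma proots_eq_mset_set:
  assumes "p \<noteq> 0" "finite S" "degree p = card S" "\<And>x. x \<in> S \<Longrightarrow> poly p x = 0"
  shows "proots p = mset_set S"
proof -
  have "S \<subseteq> set_mset (proots p)"
    using assms by auto
  then have "mset_set S \<subseteq># proots p"
    by (metis finite_set_mset mset_set_set_mset_msubset subset_imp_msubset_mset_set subset_mset.order_trans)
  moreover have "size (proots p) \<le> size (mset_set S)"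
    using assms size_proots_le[of p] by simp
  ultimately show ?thesis
    by (metis mset_subset_size not_less subset_mset.le_neq_trans)
qed

section \<open>Characteristic polynomials of labelled matrices\<close>

lemma degree_char_poly_to_mat [simp]: "degree (char_poly (to_mat V a)) = card V"
  and lead_coeff_char_poly_to_mat [simp]: "coeff (char_poly (to_mat V a)) (card V) = 1"
  and char_poly_to_mat_nonzero [simp]: "char_poly (to_mat V a) \<noteq> 0"
  using degree_monic_char_poly[OF to_mat_carrier, of V a] by auto

lemma poly_char_poly_to_mat:
  assumes "finite V"
  shows "poly (char_poly (to_mat V a)) x =
    principal_det V (\<lambda>k l. (if k = l then x else 0) - complex_of_real (a k l))"
  unfolding char_poly_to_mat[OF assms] principal_det_def poly_sum poly_mult poly_prod poly_of_int
  by (intro sum.cong refl arg_cong2[where f = "(*)"] prod.cong) auto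

lemma char_poly_to_mat_Un:
  assumes "finite C" "finite C'" "C \<inter> C' = {}" "\<And>k l. k \<in> C \<Longrightarrow> l \<in> C' \<Longrightarrow> a k l = 0"
  shows "char_poly (to_mat (C \<union> C') a) = char_poly (to_mat C a) * char_poly (to_mat C' a)"
proof -
  have "finite (C \<union> C')" using assms by simp
  then show ?thesis
    using assms by (simp only: char_poly_to_mat) (rule principal_det_block_triangular; force)
qed

lemma char_poly_to_mat_cut_edge:
  assumes "finite C" "finite C'" "C \<inter> C' = {}" "j \<in> C" "w \<in> C'"
    and "\<And>k l. k \<in> C \<Longrightarrow> l \<in> C' \<Longrightarrow> (k, l) \<noteq> (j, w) \<Longrightarrow> a k l = 0 \<and> a l k = 0"
  shows "char_poly (to_mat (C \<union> C') a) = char_poly (to_mat C a) * char_poly (to_mat C' a)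
    - [:complex_of_real (a j w * a w j):]
      * char_poly (to_mat (C - {j}) a) * char_poly (to_mat (C' - {w}) a)"
proof -
  let ?M = "\<lambda>k l. (if k = l then [:0, 1:] else 0) - [:complex_of_real (a k l):]"
  have "principal_det (C \<union> C') ?M = principal_det C ?M * principal_det C' ?M
    - ?M j w * ?M w j * principal_det (C - {j}) ?M * principal_det (C' - {w}) ?M"
    using assms by (intro principal_det_cut_edge) force+
  \<comment> \<open>\<open>j\<close> and \<open>w\<close> lie in disjoint sets, so neither factor
    contains the variable, and the two minus signs cancel.\<close>
  moreover have "?M j w * ?M w j = [:complex_of_real (a j w * a w j):]"
    using assms by auto
  ultimately show ?thesis
    using assms by (simp only: char_poly_to_mat finite_Un finite_Diff simp_thms)
qed

text \<open>
  For skew-symmetric \<open>a\<close> this is the characteristic polynomial of the Hermitian matrix \<open>- \<i> a\<close>, a real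
  function, which makes the intermediate value theorem available.
\<close>

definition hermitian_char_fun :: "nat set \<Rightarrow> (nat \<Rightarrow> nat \<Rightarrow> real) \<Rightarrow> real \<Rightarrow> real" where
  "hermitian_char_fun V a t = Re (poly (char_poly (to_mat V a)) (\<i> * of_real t) / \<i> ^ card V)"

text \<open>The entrywise conjugate of \<open>\<i> t I - a\<close> is the negative of its transpose.
  Conjugation therefore multiplies the determinant by \<open>(- 1) ^ card V\<close>, exactly as it
  does \<open>\<i> ^ card V\<close>, and their quotient is real.\<close>

lemma poly_char_poly_imaginary:
  assumes "finite V" "skew_symmetric_on V a"
  shows "poly (char_poly (to_mat V a)) (\<i> * of_real t)
    = \<i> ^ card V * of_real (hermitian_char_fun V a t)"
proof -
  let ?p = "poly (char_poly (to_mat V a)) (\<i> * of_real t)"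
  let ?M = "\<lambda>k l. (if k = l then \<i> * of_real t else 0) - complex_of_real (a k l)"
  have "cnj ?p = principal_det V (\<lambda>k l. cnj (?M k l))"
    by (simp add: poly_char_poly_to_mat assms principal_det_def cnj_sum cnj_prod)
  also have "\<dots> = principal_det V (\<lambda>k l. - ?M l k)"
  proof (rule principal_det_cong)
    fix k l assume "k \<in> V" "l \<in> V"
    then have "a k l = - a l k"
      using assms unfolding skew_symmetric_on_def by blast
    then show "cnj (?M k l) = - ?M l k" by auto
  qed
  also have "\<dots> = principal_det V (\<lambda>k l. - ?M k l)"
    using assms(1) by (rule principal_det_transpose)
  also have "\<dots> = (- 1) ^ card V * ?p"
    by (simp add: poly_char_poly_to_mat assms principal_det_def prod_uminus sum_distrib_left mult_ac
      del: minus_diff_eq)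
  finally have "cnj (?p / \<i> ^ card V) = ?p / \<i> ^ card V"
    by (simp add: power_minus[of \<i>])
  then have "?p / \<i> ^ card V \<in> \<real>"
    by (simp only: Reals_cnj_iff)
  then show ?thesis
    unfolding hermitian_char_fun_def by (simp add: field_simps)
qed

text \<open>Each of the \<open>card V\<close> linear factors contributes one factor
  \<open>\<i>\<close>, and the normalization cancels these.\<close>

lemma hermitian_char_fun_spectrum:
  assumes "spectrum_mset V a = image_mset (\<lambda>t. \<i> * complex_of_real t) M"
  shows "hermitian_char_fun V a t = (\<Prod>x\<in>#M. t - x)"
proof -
  let ?p = "char_poly (to_mat V a)"
  have "?p = (\<Prod>x\<in>#M. [:- (\<i> * complex_of_real x), 1:])"
    using complex_poly_decompose_multiset[of ?p] assms
    by (simp add: spectrum_mset_def image_mset.compositionality o_def)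
  then have "poly ?p (\<i> * of_real t) = (\<Prod>x\<in>#M. \<i> * of_real t - \<i> * of_real x)"
    by (simp add: poly_prod_mset image_mset.compositionality o_def)
  also have "\<dots> = (\<Prod>x\<in>#M. \<i> * of_real (t - x))"
    by (simp add: algebra_simps)
  also have "\<dots> = \<i> ^ size M * of_real (\<Prod>x\<in>#M. t - x)"
    by (induction M) simp_all
  also have "size M = card V"
    using arg_cong[OF assms, of size] size_proots_complex[of ?p] by (simp add: spectrum_mset_def)
  finally show ?thesis
    by (simp add: hermitian_char_fun_def)
qed

lemma continuous_on_hermitian_char_fun: "continuous_on S (hermitian_char_fun V a)"
  unfolding hermitian_char_fun_def by (intro continuous_intros) auto

text \<open>Skew-symmetry turns \<open>a j w * a w j\<close> into \<open>- (a w j)\<^sup>2\<close>,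
  which makes the edge term of the characteristic polynomial positive. The two deleted vertices
  account for a factor \<open>\<i> * \<i> = - 1\<close>, which makes it negative again.\<close>

lemma hermitian_char_fun_cut_edge:
  assumes "finite C" "finite C'" "C \<inter> C' = {}" "j \<in> C" "w \<in> C'"
    and "\<And>k l. k \<in> C \<Longrightarrow> l \<in> C' \<Longrightarrow> (k, l) \<noteq> (j, w) \<Longrightarrow> a k l = 0 \<and> a l k = 0"
    and skew: "skew_symmetric_on (C \<union> C') a"
  shows "hermitian_char_fun (C \<union> C') a t = hermitian_char_fun C a t * hermitian_char_fun C' a t
    - (a w j)\<^sup>2 * hermitian_char_fun (C - {j}) a t * hermitian_char_fun (C' - {w}) a t"
proof -
  have sub: "skew_symmetric_on W a" if "W \<subseteq> C \<union> C'" for W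
    using skew that unfolding skew_symmetric_on_def by blast
  have "a j w = - a w j"
    using skew assms(4,5) unfolding skew_symmetric_on_def by blast
  then have "poly (char_poly (to_mat (C \<union> C') a)) (\<i> * of_real t)
    = poly (char_poly (to_mat C a)) (\<i> * of_real t) * poly (char_poly (to_mat C' a)) (\<i> * of_real t)
    + of_real ((a w j)\<^sup>2) * poly (char_poly (to_mat (C - {j}) a)) (\<i> * of_real t)
      * poly (char_poly (to_mat (C' - {w}) a)) (\<i> * of_real t)"
    using char_poly_to_mat_cut_edge[OF assms(1-6)] by (simp add: power2_eq_square)
  moreover have "finite (C \<union> C')" "finite (C - {j})" "finite (C' - {w})"
    using assms by auto
  ultimately have *: "\<i> ^ card (C \<union> C') * of_real (hermitian_char_fun (C \<union> C') a t)
    = \<i> ^ card C * of_real (hermitian_char_fun C a t)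
      * (\<i> ^ card C' * of_real (hermitian_char_fun C' a t))
    + of_real ((a w j)\<^sup>2) * (\<i> ^ card (C - {j}) * of_real (hermitian_char_fun (C - {j}) a t))
      * (\<i> ^ card (C' - {w}) * of_real (hermitian_char_fun (C' - {w}) a t))"
    using assms(1,2) by (simp only: poly_char_poly_imaginary sub Un_upper1 Un_upper2 order_refl
      le_supI1 le_supI2 Diff_subset)
  obtain m n where cards: "card (C - {j}) = m" "card C = Suc m" "card (C' - {w}) = n" "card C' = Suc n"
    using assms card_Suc_Diff1 by metis
  have "\<i> ^ Suc m * \<i> ^ Suc n = (\<i> * \<i>) * (\<i> ^ m * \<i> ^ n)"
    by (simp only: power_Suc mult_ac)
  then have pow: "\<i> ^ card (C \<union> C') = \<i> ^ card C * \<i> ^ card C'"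
    "\<i> ^ card (C - {j}) * \<i> ^ card (C' - {w}) = - (\<i> ^ card C * \<i> ^ card C')"
    using assms by (simp_all only: card_Un_disjoint power_add cards) simp
  have "\<i> ^ card C * \<i> ^ card C' * of_real (hermitian_char_fun (C \<union> C') a t)
    = \<i> ^ card C * \<i> ^ card C' * of_real (hermitian_char_fun C a t * hermitian_char_fun C' a t)
    + of_real ((a w j)\<^sup>2) * (\<i> ^ card (C - {j}) * \<i> ^ card (C' - {w}))
      * of_real (hermitian_char_fun (C - {j}) a t * hermitian_char_fun (C' - {w}) a t)"
    using * unfolding pow(1) by (simp add: mult_ac)
  also have "\<dots> = \<i> ^ card C * \<i> ^ card C' * of_real
    (hermitian_char_fun C a t * hermitian_char_fun C' a t
     - (a w j)\<^sup>2 * hermitian_char_fun (C - {j}) a t * hermitian_char_fun (C' - {w}) a t)"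
    unfolding pow(2) by (simp add: algebra_simps)
  finally have "complex_of_real (hermitian_char_fun (C \<union> C') a t) = of_real
    (hermitian_char_fun C a t * hermitian_char_fun C' a t
     - (a w j)\<^sup>2 * hermitian_char_fun (C - {j}) a t * hermitian_char_fun (C' - {w}) a t)"
    by simp
  then show ?thesis
    by (simp only: of_real_eq_iff)
qed

section \<open>From the root of a tree to its branches\<close>

lemma strictly_interlaces_branch:
  assumes fin: "finite C" "finite C'" and disj: "C \<inter> C' = {}" and j: "j \<in> C" and w: "w \<in> C'"
    and cross: "\<And>k l. k \<in> C \<Longrightarrow> l \<in> C' \<Longrightarrow> (k, l) \<noteq> (j, w) \<Longrightarrow> a k l = 0 \<and> a l k = 0"
    and skew: "skew_symmetric_on (C \<union> C') a" and edge: "a w j \<noteq> 0"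
    and inter: "strictly_interlaces (spectrum_mset (C \<union> C' - {w}) a) (spectrum_mset (C \<union> C') a)"
  shows "strictly_interlaces (spectrum_mset (C - {j}) a) (spectrum_mset C a)"
proof -
  let ?V = "C \<union> C'" and ?f = "\<lambda>t. \<i> * complex_of_real t" and ?R = "\<lambda>W. hermitian_char_fun W a"
  from inter obtain as bs where as: "spectrum_mset ?V a = image_mset ?f (mset as)"
    and bs: "spectrum_mset (?V - {w}) a = image_mset ?f (mset bs)"
    and len: "length as = Suc (length bs)"
    and chain: "\<forall>k<length bs. as ! k < bs ! k \<and> bs ! k < as ! Suc k"
    unfolding strictly_interlaces_def by blast
  have "bs ! i < bs ! Suc i" if "Suc i < length bs" for i
    using chain that by (meson Suc_lessD less_trans)
  then have "sorted_wrt (<) bs"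
    by (simp add: sorted_wrt_iff_nth_Suc_transp)
  then have dist: "distinct bs"
    using strict_sorted_iff by blast
  have "?V - {w} = C \<union> (C' - {w})" using disj w j by blast
  moreover have "char_poly (to_mat (C \<union> (C' - {w})) a)
      = char_poly (to_mat C a) * char_poly (to_mat (C' - {w}) a)"
    using fin disj cross by (intro char_poly_to_mat_Un) auto
  ultimately have "spectrum_mset (?V - {w}) a = spectrum_mset C a + spectrum_mset (C' - {w}) a"
    by (simp add: spectrum_mset_def proots_mult)
  with bs have "image_mset ?f (mset bs) = spectrum_mset C a + spectrum_mset (C' - {w}) a"
    by simp
  then obtain P Q where PQ: "mset bs = P + Q"
    and P: "spectrum_mset C a = image_mset ?f P" and Q: "spectrum_mset (C' - {w}) a = image_mset ?f Q"
    by (blast dest: image_mset_eq_plusD)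
  define S where "S = set_mset P"
  \<comment> \<open>Since \<open>bs\<close> has no repetitions, each of its entries lies in exactly
    one of \<open>P\<close> and \<open>Q\<close>. So the roots belonging to \<open>C\<close> are
    simple, and the others form \<open>set bs - S\<close>.\<close>
  have "mset_set (set bs) = P + Q"
    using PQ dist by (simp add: mset_set_set)
  then have count: "count P x + count Q x = count (mset_set (set bs)) x" for x
    by simp
  have "S \<subseteq> set bs"
    using PQ by (metis S_def set_mset_mset set_mset_union sup_ge1)
  moreover have "finite S"
    by (simp add: S_def)
  moreover have "P = mset_set S"
  proof (rule multiset_eqI)
    fix x show "count P x = count (mset_set S) x"
      using count[of x] count_greater_zero_iff[of P x]
      by (cases "count P x") (auto simp: S_def count_mset_set' split: if_splits)
  qed
  moreover have "Q = mset_set (set bs - S)"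
  proof (rule multiset_eqI)
    fix x show "count Q x = count (mset_set (set bs - S)) x"
      using count[of x] count_greater_zero_iff[of P x]
      by (cases "count P x") (auto simp: S_def count_mset_set' split: if_splits)
  qed
  ultimately have S: "P = mset_set S" "Q = mset_set (set bs - S)" "S \<subseteq> set bs" "finite S"
    by blast+
  have RV: "?R ?V t = (\<Prod>i<length as. t - as ! i)" for t
  proof -
    have "?R ?V t = prod_list (map (\<lambda>x. t - x) as)"
      unfolding hermitian_char_fun_spectrum[OF as] by (metis mset_map prod_mset_prod_list)
    then show ?thesis
      by (simp add: prod.list_conv_set_nth atLeast0LessThan)
  qed
  have RC: "?R C t = (\<Prod>x\<in>S. t - x)" and RC': "?R (C' - {w}) t = (\<Prod>x\<in>set bs - S. t - x)" for t
    unfolding hermitian_char_fun_spectrum[OF P] hermitian_char_fun_spectrum[OF Q] S(1,2)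
    by (simp_all add: prod_unfold_prod_mset)
  \<comment> \<open>By \<open>RC\<close> the product is the derivative of \<open>?R C\<close> at
    \<open>c\<close>, so the claim is that \<open>?R (C - {j}) / ?R C\<close> has a positive residue
    at \<open>c\<close>.\<close>
  have residue: "?R (C - {j}) c * (\<Prod>x\<in>S - {c}. c - x) > 0" if c: "c \<in> S" for c
  proof -
    obtain k where k: "k < length bs" "c = bs ! k"
      using c S(3) by (metis in_set_conv_nth subsetD)
    have "?R C c = 0"
      unfolding RC using c S(4) by auto
    then have "?R ?V c = - (a w j)\<^sup>2 * ?R (C - {j}) c * ?R (C' - {w}) c"
      using hermitian_char_fun_cut_edge[OF fin disj j w cross skew] by simp
    moreover have "(\<Prod>x\<in>set bs - {c}. c - x) = (\<Prod>x\<in>S - {c}. c - x) * ?R (C' - {w}) c"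
    proof -
      have "set bs - {c} = (S - {c}) \<union> (set bs - S)"
        using c S(3) by blast
      then show ?thesis
        unfolding RC' by (subst prod.union_disjoint[symmetric]) (use S(4) in auto)
    qed
    moreover have "?R ?V c * (\<Prod>x\<in>set bs - {c}. c - x) < 0"
      unfolding RV k(2) prod_minus_nth_distinct[OF dist k(1)]
      by (rule interlacing_sign[OF len chain k(1)])
    \<comment> \<open>\<open>?R (C' - {w}) c\<close> occurs once in \<open>?R ?V c\<close> and once
      in the product over \<open>set bs - {c}\<close>, so it enters only through its square; the
      minus sign of the edge term reverses the inequality.\<close>
    ultimately have "(a w j * ?R (C' - {w}) c)\<^sup>2 * (?R (C - {j}) c * (\<Prod>x\<in>S - {c}. c - x)) > 0"
      by (simp add: power2_eq_square mult_ac)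
    then show ?thesis
      by (simp add: zero_less_mult_iff)
  qed
  define cs where "cs = sorted_list_of_set S"
  have cs: "sorted_wrt (<) cs" "set cs = S" "distinct cs"
    using S(4) by (simp_all add: cs_def)
  then have mset_cs: "mset cs = P"
    using S(1) mset_set_set by metis
  have "size P = card C"
    using arg_cong[OF P, of size] size_proots_complex[of "char_poly (to_mat C a)"]
    by (simp add: spectrum_mset_def)
  then have "length cs = card C"
    by (metis mset_cs size_mset)
  \<comment> \<open>There are as many gaps between consecutive roots of \<open>?R C\<close> as the
    degree of the characteristic polynomial of \<open>C - {j}\<close>, so one root found in each gap
    will account for all of them.\<close>
  then have len_cs: "length cs = Suc (card (C - {j}))"
    using fin j by (metis card_Suc_Diff1)
  have "\<exists>d. cs ! k < d \<and> d < cs ! Suc k \<and> ?R (C - {j}) d = 0" if k: "Suc k < length cs" for k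
  proof -
    let ?c = "cs ! k" and ?d = "cs ! Suc k"
    have mem: "?c \<in> S" "?d \<in> S" "?c < ?d"
      using k cs by (auto simp: sorted_wrt_iff_nth_less)
    have "x \<le> ?c \<or> ?d \<le> x" if x: "x \<in> S" for x
    proof -
      obtain i where i: "i < length cs" "x = cs ! i"
        using x cs(2) by (metis in_set_conv_nth)
      show ?thesis
        using i k cs(1) strict_sorted_imp_sorted[OF cs(1)]
        by (cases "i \<le> k") (auto intro: sorted_nth_mono)
    qed
    then have "(\<Prod>x\<in>S - {?c}. ?c - x) * (\<Prod>x\<in>S - {?d}. ?d - x) < 0"
      by (intro consecutive_roots_sign mem S)
    \<comment> \<open>By \<open>residue\<close>, \<open>?R (C - {j})\<close> has the sign of the
      derivative of \<open>?R C\<close> at both roots, and that derivative changes sign between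
      them.\<close>
    with residue[OF mem(1)] residue[OF mem(2)]
    have neg: "?R (C - {j}) ?c * ?R (C - {j}) ?d < 0"
      by (auto simp: zero_less_mult_iff mult_less_0_iff)
    \<comment> \<open>The intermediate value theorem yields a root in the closed interval, in the
      version that fits the sign at \<open>?c\<close>; by \<open>neg\<close> neither endpoint is a
      root.\<close>
    obtain x where x: "?c \<le> x" "x \<le> ?d" "?R (C - {j}) x = 0"
    proof (cases "?R (C - {j}) ?c \<le> 0")
      case True
      with neg have "?R (C - {j}) ?c \<le> 0" "0 \<le> ?R (C - {j}) ?d"
        by (auto simp: mult_less_0_iff)
      then show thesis
        using IVT'[of "?R (C - {j})" ?c 0 ?d] mem(3) continuous_on_hermitian_char_fun that by auto
    next
      case False
      with neg have "?R (C - {j}) ?d \<le> 0" "0 \<le> ?R (C - {j}) ?c"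
        by (auto simp: mult_less_0_iff)
      then show thesis
        using IVT2'[of "?R (C - {j})" ?d 0 ?c] mem(3) continuous_on_hermitian_char_fun that by auto
    qed
    with neg show ?thesis
      by (metis less_eq_real_def mult_zero_left mult_zero_right less_irrefl)
  qed
  then obtain d where d: "\<And>k. Suc k < length cs \<Longrightarrow> cs ! k < d k \<and> d k < cs ! Suc k \<and> ?R (C - {j}) (d k) = 0"
    by metis
  define ds where "ds = map d [0..<card (C - {j})]"
  have len_ds: "length ds = card (C - {j})"
    by (simp add: ds_def)
  have chain': "\<forall>k<length ds. cs ! k < ds ! k \<and> ds ! k < cs ! Suc k"
    using d len_cs by (simp add: ds_def)
  have "ds ! i < ds ! Suc i" if "Suc i < length ds" for i
    using chain' that by (meson Suc_lessD less_trans)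
  then have "sorted_wrt (<) ds"
    by (simp add: sorted_wrt_iff_nth_Suc_transp)
  then have dist': "distinct ds"
    using strict_sorted_iff by blast
  have inj: "inj_on ?f (set ds)"
    by (auto intro: inj_onI)
  have "spectrum_mset (C - {j}) a = mset_set (?f ` set ds)"
    unfolding spectrum_mset_def
  proof (rule proots_eq_mset_set)
    show "degree (char_poly (to_mat (C - {j}) a)) = card (?f ` set ds)"
      by (simp add: card_image[OF inj] distinct_card[OF dist'] len_ds)
    fix x assume "x \<in> ?f ` set ds"
    then obtain k where k: "k < length ds" "x = ?f (ds ! k)"
      by (auto simp: in_set_conv_nth)
    have "skew_symmetric_on (C - {j}) a"
      using skew unfolding skew_symmetric_on_def by blast
    moreover have "?R (C - {j}) (ds ! k) = 0"
      using d[of k] k len_cs len_ds by (simp add: ds_def)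
    ultimately show "poly (char_poly (to_mat (C - {j}) a)) x = 0"
      using fin k by (simp add: poly_char_poly_imaginary)
  qed auto
  also have "\<dots> = image_mset ?f (mset ds)"
    by (simp only: image_mset_mset_set[OF inj, symmetric] mset_set_set[OF dist'])
  finally show ?thesis
    unfolding strictly_interlaces_def using P mset_cs len_cs len_ds chain'
    by (intro exI[of _ cs] exI[of _ ds]) simp
qed

text \<open>Strong induction on the number of labels: each branch is the graph of a smaller
  principal submatrix, and \<open>strictly_interlaces_branch\<close> provides the interlacing at its
  attachment vertex, the root for the next step.\<close>

lemma Duarte_if_strictly_interlaces:
  assumes "finite V" "skew_symmetric_on V a" "is_tree (matrix_graph V a)" "w \<in> V"
    and "strictly_interlaces (spectrum_mset (V - {w}) a) (spectrum_mset V a)"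
  shows "Duarte V a w"
  using assms
proof (induction "card V" arbitrary: V w rule: less_induct)
  case less
  note tree = less.prems(3)
  let ?T = "matrix_graph V a"
  show ?case
  proof (cases "1 < card V")
    case False
    moreover have "card V > 0"
      using less.prems(1,4) by (auto simp: card_gt_0_iff)
    ultimately have "card V = 1" by simp
    with less.prems(4) have "V = {w}"
      by (metis card_1_singletonE singletonD)
    then show ?thesis by (rule Duarte_single)
  next
    case True
    have graph: "pair_graph ?T"
      using tree by (simp add: is_tree_def)
    note arc = matrix_graph_arc[OF less.prems(2)]
    have "Duarte (pverts (branch ?T w u)) a u" if "u \<in> neighbors ?T w" for u
    proof -
      define C where "C = pverts (branch ?T w u)"
      have wu: "(w, u) \<in> parcs ?T"
        using that by simp
      have uC: "u \<in> C"
        unfolding C_def using graph wu by (rule self_in_branch)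
      have CV: "C \<subseteq> V - {w}"
        using pverts_branch_subset[OF graph, of w u] by (simp add: C_def matrix_graph_def)
      have V: "C \<union> V = V" and fin: "finite C" "finite (V - C)"
        using CV less.prems(1) finite_subset by auto
      \<comment> \<open>An arc leaving the branch can only end at \<open>w\<close> since the branch
        is a component of \<open>T(w)\<close>, and \<open>u\<close> is the only neighbor of
        \<open>w\<close> in the branch.\<close>
      have "a k l = 0 \<and> a l k = 0" if kl: "k \<in> C" "l \<in> V - C" "(k, l) \<noteq> (u, w)" for k l
      proof -
        have "(k, l) \<notin> parcs ?T"
        proof
          assume kl_arc: "(k, l) \<in> parcs ?T"
          then have "l = w"
            using branch_closed[OF graph _ kl_arc] kl(1,2) by (auto simp: C_def)
          moreover from this have "(w, k) \<in> parcs ?T"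
            using kl_arc graph by (simp add: pair_graph_def pair_pseudo_graph_def pair_sym_digraph.arcs_symmetric)
          then have "k = u"
            using branch_single_attachment[OF tree wu] kl(1) by (simp add: C_def)
          ultimately show False using kl(3) by simp
        qed
        moreover have "a l k = - a k l"
          using kl CV less.prems(2) unfolding skew_symmetric_on_def by blast
        ultimately show ?thesis
          using kl CV by (auto simp: arc)
      qed
      then have "strictly_interlaces (spectrum_mset (C - {u}) a) (spectrum_mset C a)"
        using less.prems(2,5) wu uC CV less.prems(4)
        by (intro strictly_interlaces_branch[OF fin, of u w]) (auto simp: arc V)
      moreover have "is_tree (matrix_graph C a)"
        using is_tree_branch[OF tree wu] matrix_graph_branch[OF C_def] by simp
      moreover have "skew_symmetric_on C a"
        using less.prems(2) CV unfolding skew_symmetric_on_def by blast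
      moreover have "card C < card V"
        using CV less.prems(1,4) by (intro psubset_card_mono) auto
      ultimately show ?thesis
        unfolding C_def[symmetric] using less.hyps fin(1) uC by blast
    qed
    then show ?thesis
      using tree less.prems True by (intro Duarte_branch) auto
  qed
qed

theorem corollary3p5:
  fixes T :: ugraph and n v :: nat and lam mu :: "nat \<Rightarrow> real" and A :: "nat \<Rightarrow> nat \<Rightarrow> real"
  assumes "is_tree T" and "pverts T = {1..n}" and "2 \<le> n"
    and "\<forall>k\<in>{1..n - 1}. lam k < mu k \<and> mu k < lam (k + 1)"
    and "\<forall>j\<in>{1..n}. lam j = - lam (n + 1 - j)"
    and "\<forall>k\<in>{1..n - 1}. mu k = - mu (n - k)"
    and "v \<in> {1..n}" and "NEB T v"
    and "A \<in> skew_matrices T"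
    and "spectrum_mset {1..n} A = {#\<i> * complex_of_real (lam j). j \<in># mset_set {1..n}#}"
    and "spectrum_mset ({1..n} - {v}) A = {#\<i> * complex_of_real (mu k). k \<in># mset_set {1..n - 1}#}"
    and "constructed T v lam mu A"
  shows "Duarte {1..n} A v"
proof -
  \<comment> \<open>The data are indexed from 1 and lists from 0, so entry \<open>k\<close> of
    \<open>?as\<close> is \<open>lam (Suc k)\<close>, and likewise for \<open>?bs\<close>.\<close>
  let ?as = "map lam [1..<Suc n]" and ?bs = "map mu [1..<Suc (n - 1)]"
  have spectra: "spectrum_mset {1..n} A = image_mset (\<lambda>t. \<i> * complex_of_real t) (mset ?as)"
    "spectrum_mset ({1..n} - {v}) A = image_mset (\<lambda>t. \<i> * complex_of_real t) (mset ?bs)"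
    unfolding assms(10,11)
    by (simp_all add: image_mset.compositionality o_def atLeastLessThanSuc_atLeastAtMost
      del: upt_Suc)
  have "length ?as = Suc (length ?bs)"
    using assms(3) by simp
  moreover have "?as ! k < ?bs ! k \<and> ?bs ! k < ?as ! Suc k" if "k < length ?bs" for k
    using that bspec[OF assms(4), of "Suc k"] by (simp del: upt_Suc)
  ultimately have "strictly_interlaces (spectrum_mset ({1..n} - {v}) A) (spectrum_mset {1..n} A)"
    unfolding strictly_interlaces_def using spectra by blast
  then show ?thesis
    using assms by (intro Duarte_if_strictly_interlaces) (auto simp: skew_matrices_def)
qed

end
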